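(* Let $V$ be a finite ground set with $|V|=n$, let $f:2^V\to\mathbb{R}_{\ge 0}$ be a normalized, monotone, $\gamma$-weakly submodular function with $\gamma\in(0,1]$, and let $c$ be a modular cost function with $c(x)>0$ for all $x\in V$. Let ${\rm OPT}\in\arg\max_{T\subseteq V}\{f(T)-c(T)\}$. Then the modified ROI algorithm (described in the context) makes $\mathcal{O}(n^2)$ oracle calls to $f$ and outputs $\tilde S$ such that \[ f(\tilde S)-c(\tilde S)\ge\gamma f({\rm OPT})-c({\rm OPT})-\frac{c({\rm OPT})}{\gamma}\log\frac{f({\rm OPT})}{c({\rm OPT})}. \]
   Context: For $S\subseteq V$, $x\in V$: $f(x\mid S)=f(S\cup\{x\})-f(S)$. $f$ is $\gamma$-weakly submodular if for all $S\subseteq T\subseteq V$: $\sum_{u\in T\setminus S}f(u\mid S)\ge\gamma\,(f(T)-f(S))$. Modular cost: $c(S)=\sum_{x\in S}c(x)$. Here $\log$ is the natural logarithm. Modified ROI algorithm: start with $S_0=\emptyset$; for at most $n$ iterations, given the current partial solution $S_{i-1}$, pick $v_i\in V\setminus S_{i-1}$ maximizing the density $f(v\mid S_{i-1})/c(v)$; if this maximal density is greater than $\gamma$, set $S_i=S_{i-1}\cup\{v_i\}$, otherwise stop. Output $\tilde S$, the partial solution $S_i$ (over all constructed $S_i$) maximizing $f(S_i)-c(S_i)$. *)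

theory Defs
  imports Complex_Main "HOL-Library.Landau_Symbols"
begin

definition marginal :: "('a set \<Rightarrow> real) \<Rightarrow> 'a \<Rightarrow> 'a set \<Rightarrow> real" where
  "marginal f x S = f (S \<union> {x}) - f S"

definition weakly_submodular_on :: "'a set \<Rightarrow> real \<Rightarrow> ('a set \<Rightarrow> real) \<Rightarrow> bool" where
  "weakly_submodular_on V \<gamma> f \<longleftrightarrow>
     (\<forall>S T. S \<subseteq> T \<and> T \<subseteq> V \<longrightarrow> (\<Sum>u\<in>T - S. marginal f u S) \<ge> \<gamma> * (f T - f S))"

definition maximizers :: "('b \<Rightarrow> real) \<Rightarrow> 'b set \<Rightarrow> 'b set" where
  "maximizers g A = {x. is_arg_max g (\<lambda>y. y \<in> A) x}"

text \<open>
  Computations with access to an oracle: the only way for a program to learn anything about the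
  oracle is an \<open>Ask\<close> node, and \<open>num_calls\<close> counts the \<open>Ask\<close> nodes met when the oracle is \<open>f\<close>.
\<close>

datatype ('q, 'r, 'b) oracle_prog =
  Return 'b
| Ask 'q "'r \<Rightarrow> ('q, 'r, 'b) oracle_prog"

primrec result :: "('q \<Rightarrow> 'r) \<Rightarrow> ('q, 'r, 'b) oracle_prog \<Rightarrow> 'b" where
  "result f (Return x) = x"
| "result f (Ask q k) = result f (k (f q))"

primrec num_calls :: "('q \<Rightarrow> 'r) \<Rightarrow> ('q, 'r, 'b) oracle_prog \<Rightarrow> nat" where
  "num_calls f (Return x) = 0"
| "num_calls f (Ask q k) = Suc (num_calls f (k (f q)))"

primrec bind_prog ::
  "('q, 'r, 'b) oracle_prog \<Rightarrow> ('b \<Rightarrow> ('q, 'r, 'd) oracle_prog) \<Rightarrow> ('q, 'r, 'd) oracle_prog" where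
  "bind_prog (Return x) g = g x"
| "bind_prog (Ask q k) g = Ask q (\<lambda>r. bind_prog (k r) g)"

text \<open>Runs \<open>p\<close> on every element of a list and returns the table of results.\<close>

primrec tabulate :: "('x \<Rightarrow> ('q, 'r, real) oracle_prog) \<Rightarrow> 'x list \<Rightarrow> ('q, 'r, 'x \<Rightarrow> real) oracle_prog" where
  "tabulate p [] = Return (\<lambda>_. 0)"
| "tabulate p (x # xs) =
     bind_prog (p x) (\<lambda>r. bind_prog (tabulate p xs) (\<lambda>g. Return (g(x := r))))"

definition query_density :: "('a \<Rightarrow> real) \<Rightarrow> 'a set \<Rightarrow> 'a \<Rightarrow> ('a set, real, real) oracle_prog" where
  "query_density c S v = Ask (S \<union> {v}) (\<lambda>a. Ask S (\<lambda>b. Return ((a - b) / c v)))"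

definition query_profit :: "('a \<Rightarrow> real) \<Rightarrow> 'a set \<Rightarrow> ('a set, real, real) oracle_prog" where
  "query_profit c S = Ask S (\<lambda>a. Return (a - sum c S))"

text \<open>
  The ground set is given by an enumeration \<open>vs\<close>, which fixes the order of the oracle calls.
  The function \<open>tie\<close> selects one element of the set of density maximizers. A choice function on
  sets suffices to express every way of breaking ties, since the sets of maximizers met in one run
  are pairwise distinct: the element selected from one of them is in none of the later ones.
  At most \<open>k\<close> further iterations are performed from \<open>S\<close>; the result lists the partial solutions
  from \<open>S\<close> onwards. Starting from \<open>{}\<close> with \<open>k = length vs\<close>, there always is
  an element outside \<open>S\<close> when an iteration begins.
\<close>

primrec roi_loop ::
  "'a list \<Rightarrow> ('a \<Rightarrow> real) \<Rightarrow> real \<Rightarrow> ('a set \<Rightarrow> 'a) \<Rightarrow> nat \<Rightarrow> 'a set \<Rightarrow> ('a set, real, 'a set list) oracle_prog"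
where
  "roi_loop vs c \<gamma> tie 0 S = Return [S]"
| "roi_loop vs c \<gamma> tie (Suc k) S =
     bind_prog (tabulate (query_density c S) (filter (\<lambda>v. v \<notin> S) vs))
       (\<lambda>d. let v = tie (maximizers d (set vs - S)) in
          if d v > \<gamma>
          then bind_prog (roi_loop vs c \<gamma> tie k (S \<union> {v})) (\<lambda>Ss. Return (S # Ss))
          else Return [S])"

definition modified_roi ::
  "'a list \<Rightarrow> ('a \<Rightarrow> real) \<Rightarrow> real \<Rightarrow> ('a set \<Rightarrow> 'a) \<Rightarrow> ('a set set \<Rightarrow> 'a set) \<Rightarrow> ('a set, real, 'a set) oracle_prog"
where
  "modified_roi vs c \<gamma> tie tie_out =
     bind_prog (roi_loop vs c \<gamma> tie (length vs) {})
       (\<lambda>Ss. bind_prog (tabulate (query_profit c) Ss)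
         (\<lambda>g. Return (tie_out (maximizers g (set Ss)))))"

end

theory Submission
  imports Defs
begin

text \<open>
  Write \<open>F = f OPT\<close> and \<open>C = c OPT\<close>. Weak submodularity and monotonicity bound the maximal density
  at \<open>S\<close> from below by \<open>\<gamma> * (F - f S) / C\<close>. Hence, interpolating the values of the partial solutions
  linearly in their cost \<open>x\<close>, the gap to \<open>F\<close> decays at least as fast as \<open>F * exp (- \<gamma> * x / C)\<close>, and it
  is at most \<open>C\<close> at cost \<open>x\<^sub>0 = C / \<gamma> * ln (F / C)\<close>. The interpolated profit is piecewise linear, so
  one of the two partial solutions around \<open>x\<^sub>0\<close> has profit at least \<open>F - C - x\<^sub>0\<close>. If the
  algorithm stops before cost \<open>x\<^sub>0\<close>, then the density bound makes the gap at most \<open>C\<close> there.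
\<close>

lemma result_bind_prog [simp]: "result f (bind_prog p g) = result f (g (result f p))"
  by (induction p) auto

lemma num_calls_bind_prog [simp]:
  "num_calls f (bind_prog p g) = num_calls f p + num_calls f (g (result f p))"
  by (induction p) auto

lemma result_tabulate: "x \<in> set xs \<Longrightarrow> result f (tabulate p xs) x = result f (p x)"
  by (induction xs) auto

lemma num_calls_tabulate:
  assumes "\<And>x. x \<in> set xs \<Longrightarrow> num_calls f (p x) = m"
  shows "num_calls f (tabulate p xs) = m * length xs"
  using assms by (induction xs) auto

lemma num_calls_query_density [simp]: "num_calls f (query_density c S v) = 2"
  by (simp add: query_density_def)

lemma result_query_density [simp]:
  "result f (query_density c S v) = marginal f v S / c v"
  by (simp add: query_density_def marginal_def)

lemma num_calls_query_profit [simp]: "num_calls f (query_profit c S) = 1"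
  by (simp add: query_profit_def)

lemma result_query_profit [simp]: "result f (query_profit c S) = f S - sum c S"
  by (simp add: query_profit_def)

lemma maximizers_nonempty:
  fixes g :: "'b \<Rightarrow> real"
  assumes "finite A" "A \<noteq> {}"
  shows "maximizers g A \<noteq> {}"
proof -
  have "Max (g ` A) \<in> g ` A" using assms by simp
  then obtain x where x: "x \<in> A" "g x = Max (g ` A)" by auto
  then have "is_arg_max g (\<lambda>y. y \<in> A) x"
    using assms by (simp add: is_arg_max_linorder)
  then show ?thesis by (auto simp: maximizers_def)
qed

lemma maximizersD:
  fixes g :: "'b \<Rightarrow> real"
  assumes "x \<in> maximizers g A"
  shows "x \<in> A" "\<And>y. y \<in> A \<Longrightarrow> g y \<le> g x"
  using assms by (auto simp: maximizers_def is_arg_max_linorder)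

lemma num_calls_roi_loop:
  "num_calls f (roi_loop vs c \<gamma> tie k S) \<le> 2 * length vs * k"
proof (induction k arbitrary: S)
  case (Suc k)
  have "num_calls f (tabulate (query_density c S) (filter (\<lambda>v. v \<notin> S) vs)) \<le> 2 * length vs"
    by (subst num_calls_tabulate[where m = 2]) auto
  with Suc show ?case
    by (auto simp: Let_def intro: add_mono)
qed simp

lemma length_roi_loop: "length (result f (roi_loop vs c \<gamma> tie k S)) \<le> Suc k"
  by (induction k arbitrary: S) (auto simp: Let_def)

text \<open>Supplies witnesses: the current set is available when the loop stops, and the next set
  is available even if its cost overshoots the budget.\<close>

lemma roi_loop_start: "S \<in> set (result f (roi_loop vs c \<gamma> tie k S))"
  by (cases k) (auto simp: Let_def)

text \<open>The loop accounts for the quadratic term. The rest comes from one profit query for each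
  of the at most \<open>length vs + 1\<close> partial solutions, \<open>{}\<close> included.\<close>

lemma num_calls_modified_roi:
  "num_calls f (modified_roi vs c \<gamma> tie tie_out) \<le> 2 * (length vs)\<^sup>2 + length vs + 1"
  using num_calls_roi_loop[of f vs c \<gamma> tie "length vs" "{}"]
    length_roi_loop[of f vs c \<gamma> tie "length vs" "{}"]
  by (simp add: modified_roi_def num_calls_tabulate[where m = 1] power2_eq_square)

text \<open>The table of profits is correct only on the listed sets, which suffices because
  \<open>R\<close> and \<open>T\<close> are both listed.\<close>

lemma modified_roi_maximal:
  assumes "\<And>A. A \<noteq> {} \<Longrightarrow> tie_out A \<in> A"
    and "T \<in> set (result f (roi_loop vs c \<gamma> tie (length vs) {}))"
  defines "R \<equiv> result f (modified_roi vs c \<gamma> tie tie_out)"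
  shows "f T - sum c T \<le> f R - sum c R"
proof -
  let ?Ss = "result f (roi_loop vs c \<gamma> tie (length vs) {})"
  let ?g = "result f (tabulate (query_profit c) ?Ss)"
  have "R \<in> maximizers ?g (set ?Ss)"
    using assms(2) unfolding R_def modified_roi_def result_bind_prog result.simps(1)
    by (intro assms(1) maximizers_nonempty) auto
  from maximizersD[OF this] assms(2) show ?thesis
    by (metis result_tabulate result_query_profit)
qed

text \<open>Monotonicity replaces \<open>T\<close> by \<open>S \<union> T\<close>, so that weak
  submodularity applies to nested sets. Each marginal is then at most \<open>\<rho> * c u\<close>,
  and these nonnegative terms may be summed over all of \<open>T\<close>.\<close>

lemma density_lower_bound:
  assumes "finite V" "mono_on (Pow V) f" "weakly_submodular_on V \<gamma> f" "0 \<le> \<gamma>"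
    and c: "\<forall>x\<in>V. c x > 0"
    and sub: "S \<subseteq> V" "T \<subseteq> V"
    and "0 \<le> \<rho>" and \<rho>: "\<And>u. u \<in> V - S \<Longrightarrow> marginal f u S / c u \<le> \<rho>"
  shows "\<gamma> * (f T - f S) \<le> \<rho> * sum c T"
proof -
  have "f T \<le> f (S \<union> T)"
    using assms(2) sub by (auto intro!: mono_onD[of "Pow V" f])
  then have "\<gamma> * (f T - f S) \<le> \<gamma> * (f (S \<union> T) - f S)"
    using \<open>0 \<le> \<gamma>\<close> by (intro mult_left_mono) auto
  also have "\<dots> \<le> (\<Sum>u\<in>(S \<union> T) - S. marginal f u S)"
    using assms(3) sub unfolding weakly_submodular_on_def by (metis Un_subset_iff sup_ge1)
  also have "\<dots> \<le> (\<Sum>u\<in>(S \<union> T) - S. \<rho> * c u)"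
  proof (rule sum_mono)
    fix u assume "u \<in> (S \<union> T) - S"
    then have "u \<in> V - S" using sub by auto
    with \<rho>[of u] c show "marginal f u S \<le> \<rho> * c u" by (simp add: divide_le_eq)
  qed
  also have "\<dots> \<le> (\<Sum>u\<in>T. \<rho> * c u)"
    using \<open>finite V\<close> sub c \<open>0 \<le> \<rho>\<close>
    by (intro sum_mono2) (auto intro: finite_subset simp: subset_iff less_imp_le)
  finally show ?thesis by (simp add: sum_distrib_left)
qed

text \<open>Here \<open>h\<close> is the gap at cost \<open>x\<close>, and it shrinks at rate
  \<open>\<rho>\<close> for a further cost \<open>t\<close>. The decay comes from
  \<open>1 - a * t \<le> exp (- a * t)\<close>.\<close>

lemma exp_decay_step:
  fixes a h F :: real
  assumes "h \<le> F * exp (- a * x)" "a * h \<le> \<rho>" "0 \<le> \<rho>" "0 \<le> t" "0 \<le> F"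
  shows "h - \<rho> * t \<le> F * exp (- a * (x + t))"
\<comment> \<open>That inequality gets multiplied by \<open>h\<close>, so a nonpositive gap is
  treated by signs alone.\<close>
proof (cases "h \<le> 0")
  case True
  then have "h - \<rho> * t \<le> 0"
    using assms by (smt (verit) mult_nonneg_nonneg)
  also have "0 \<le> F * exp (- a * (x + t))"
    using assms by simp
  finally show ?thesis .
next
  case False
  have "h - \<rho> * t \<le> h - a * h * t"
    using mult_right_mono[OF assms(2) \<open>0 \<le> t\<close>] by simp
  also have "\<dots> = h * (1 + - a * t)" by (simp add: algebra_simps)
  also have "\<dots> \<le> h * exp (- a * t)"
    using False by (intro mult_left_mono exp_ge_add_one_self) auto
  also have "\<dots> \<le> F * exp (- a * x) * exp (- a * t)"
    using assms by (intro mult_right_mono) auto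
  also have "\<dots> = F * exp (- a * (x + t))"
    by (simp add: exp_add[symmetric] algebra_simps)
  finally show ?thesis .
qed

text \<open>The last three assumptions are the loop invariant: \<open>k\<close> elements remain, the
  cost is within the budget \<open>x0\<close>, and the gap has decayed exponentially in the cost.
  The induction follows the run until it stops or exceeds \<open>x0\<close>.\<close>

lemma roi_loop_profit:
  fixes f :: "'a set \<Rightarrow> real" and c :: "'a \<Rightarrow> real"
  assumes V: "finite V" "set vs = V"
    and f: "mono_on (Pow V) f" "weakly_submodular_on V \<gamma> f"
    and \<gamma>: "0 < \<gamma>"
    and c: "\<forall>x\<in>V. c x > 0"
    and tie: "\<And>A. A \<noteq> {} \<Longrightarrow> tie A \<in> A"
    and T: "T \<subseteq> V" "0 \<le> f T" "0 < sum c T"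
    and x0: "f T * exp (- (\<gamma> / sum c T) * x0) \<le> sum c T"
    and "S \<subseteq> V" "card (V - S) = k" "sum c S \<le> x0"
    and "f T - f S \<le> f T * exp (- (\<gamma> / sum c T) * sum c S)"
  shows "\<exists>R \<in> set (result f (roi_loop vs c \<gamma> tie k S)). f R - sum c R \<ge> f T - sum c T - x0"
  using assms(12-)
proof (induction k arbitrary: S)
  case 0
  \<comment> \<open>With nothing left to add, monotonicity makes the gap nonpositive.\<close>
  then have "S = V" using V by auto
  moreover have "f T \<le> f V" using f T by (auto intro!: mono_onD[of "Pow V" f])
  ultimately show ?case using 0 T by auto
next
  case (Suc k)
  let ?d = "result f (tabulate (query_density c S) (filter (\<lambda>v. v \<notin> S) vs))"
  define v where "v = tie (maximizers ?d (V - S))"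
  define \<rho> where "\<rho> = marginal f v S / c v"
  have d: "?d u = marginal f u S / c u" if "u \<in> V - S" for u
    using that V by (subst result_tabulate) auto
  have "V - S \<noteq> {}" using Suc.prems(2) by force
  then have "v \<in> maximizers ?d (V - S)"
    unfolding v_def using V by (intro tie maximizers_nonempty) auto
  note v = maximizersD[OF this]
  have dv: "?d v = \<rho>" using d v(1) by (simp add: \<rho>_def)
  have cv: "c v > 0" using v(1) c by auto
  have fin: "finite S" using Suc.prems(1) V finite_subset by blast
  have sumv: "sum c (S \<union> {v}) = sum c S + c v"
    using fin v(1) by (simp add: add.commute)
  have fv: "f (S \<union> {v}) = f S + \<rho> * c v"
    using cv by (simp add: \<rho>_def marginal_def)
  have "f S \<le> f (S \<union> {v})"
    using f v(1) Suc.prems(1) by (auto intro!: mono_onD[of "Pow V" f])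
  then have "0 \<le> \<rho>" using fv cv by (simp add: zero_le_mult_iff)
  have "marginal f u S / c u \<le> \<rho>" if "u \<in> V - S" for u
    using v(2)[OF that] dv d[OF that] by simp
  then have bound: "\<gamma> * (f T - f S) \<le> \<rho> * sum c T"
    using density_lower_bound[OF V(1) f _ c Suc.prems(1) T(1) \<open>0 \<le> \<rho>\<close>] \<gamma> by simp
  \<comment> \<open>Kept for every \<open>t\<close>: \<open>c v\<close> restores the invariant, and
    a smaller \<open>t\<close> reaches the budget exactly.\<close>
  then have step: "f T - f S - \<rho> * t \<le> f T * exp (- (\<gamma> / sum c T) * (sum c S + t))"
    if "0 \<le> t" for t
    using exp_decay_step[OF Suc.prems(4) _ \<open>0 \<le> \<rho>\<close> that T(2)] T(3) by (simp add: divide_le_eq)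
  show ?case
  proof (cases "\<rho> > \<gamma>")
    case False
    \<comment> \<open>The stopping threshold is \<open>\<gamma>\<close>, so it cancels against the
      factor in \<open>bound\<close>.\<close>
    then have "\<gamma> * (f T - f S) \<le> \<gamma> * sum c T"
      using bound T(3) by (smt (verit) mult_right_mono)
    then have "f T - f S \<le> sum c T" using \<gamma> by simp
    then show ?thesis using Suc.prems(3) by (intro bexI[OF _ roi_loop_start]) auto
  next
    case True
    have loop: "set (result f (roi_loop vs c \<gamma> tie (Suc k) S)) =
        insert S (set (result f (roi_loop vs c \<gamma> tie k (S \<union> {v}))))"
      using True dv V(2) by (simp add: Let_def v_def[symmetric])
    show ?thesis
    proof (cases "sum c (S \<union> {v}) \<le> x0")
      case True
      have "V - (S \<union> {v}) = (V - S) - {v}" by auto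
      then have "card (V - (S \<union> {v})) = k" using v(1) Suc.prems(2) by simp
      moreover have "f T - f (S \<union> {v}) \<le>
          f T * exp (- (\<gamma> / sum c T) * sum c (S \<union> {v}))"
        using step[of "c v"] cv unfolding fv sumv by simp
      ultimately show ?thesis
        using Suc.IH[of "S \<union> {v}"] True Suc.prems(1) v(1) loop by auto
    next
      case False
      \<comment> \<open>The part of the cost of \<open>v\<close> that still fits into the
        budget.\<close>
      define t where "t = x0 - sum c S"
      have t: "0 \<le> t" "t \<le> c v" using False Suc.prems(3) sumv by (auto simp: t_def)
      have "f T - f S - \<rho> * t \<le> sum c T"
        using step[OF t(1)] x0 by (simp add: t_def)
      \<comment> \<open>The right side is the interpolated profit at cost \<open>x0\<close>. It is
        linear in \<open>t\<close> with slope \<open>\<rho> - 1\<close>, whose sign decides between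
        \<open>S\<close> and \<open>S \<union> {v}\<close>.\<close>
      then have *: "f T - sum c T - x0 \<le> f S - sum c S + (\<rho> - 1) * t"
        by (simp add: t_def algebra_simps)
      show ?thesis
      proof (cases "\<rho> \<le> 1")
        case True
        then have "(\<rho> - 1) * t \<le> 0" using t by (simp add: mult_le_0_iff)
        then show ?thesis using * loop by (intro bexI[of _ S]) auto
      next
        case False
        then have "(\<rho> - 1) * t \<le> (\<rho> - 1) * c v" using t by (intro mult_left_mono) auto
        then have "f T - sum c T - x0 \<le> f (S \<union> {v}) - sum c (S \<union> {v})"
          using * unfolding fv sumv by (simp add: algebra_simps)
        then show ?thesis unfolding loop by (intro bexI[OF _ insertI2[OF roi_loop_start]])
      qed
    qed
  qed
qed

text \<open>The comparison set \<open>T\<close> only has to have nonnegative profit, which makes the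
  logarithm nonnegative for nonempty \<open>T\<close>.\<close>

lemma modified_roi_profit:
  fixes f :: "'a set \<Rightarrow> real" and c :: "'a \<Rightarrow> real"
  assumes V: "finite V" "distinct vs" "set vs = V"
    and f: "f {} = 0" "mono_on (Pow V) f" "weakly_submodular_on V \<gamma> f"
    and \<gamma>: "0 < \<gamma>" "\<gamma> \<le> 1"
    and c: "\<forall>x\<in>V. c x > 0"
    and tie: "\<And>A. A \<noteq> {} \<Longrightarrow> tie A \<in> A" "\<And>A. A \<noteq> {} \<Longrightarrow> tie_out A \<in> A"
    and T: "T \<subseteq> V" "sum c T \<le> f T"
  defines "R \<equiv> result f (modified_roi vs c \<gamma> tie tie_out)"
  shows "f R - sum c R \<ge> \<gamma> * f T - sum c T - sum c T / \<gamma> * ln (f T / sum c T)"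
proof (cases "T = {}")
  case True
  \<comment> \<open>For empty \<open>T\<close> the quotient in the logarithm is 0 / 0, but its
    coefficient is 0, so the claimed bound is 0.\<close>
  have "f {} - sum c {} \<le> f R - sum c R"
    unfolding R_def by (intro modified_roi_maximal tie(2) roi_loop_start)
  with True show ?thesis using f(1) by simp
next
  case False
  have C: "sum c T > 0"
    using False T(1) V c by (intro sum_pos) (auto intro: finite_subset)
  then have F: "f T > 0" using T(2) by simp
  \<comment> \<open>The cost at which the decay bound
    \<open>f T * exp (- (\<gamma> / sum c T) * x0)\<close> equals \<open>sum c T\<close>.\<close>
  define x0 where "x0 = sum c T / \<gamma> * ln (f T / sum c T)"
  have "f T * exp (- (\<gamma> / sum c T) * x0) = sum c T"
    using C F \<gamma> by (simp add: x0_def exp_minus)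
  moreover have "x0 \<ge> 0" using C T(2) \<gamma> by (simp add: x0_def)
  moreover have "card (V - {}) = length vs" using V distinct_card by fastforce
  ultimately obtain S where
    "S \<in> set (result f (roi_loop vs c \<gamma> tie (length vs) {}))"
    and S: "f S - sum c S \<ge> f T - sum c T - x0"
    using roi_loop_profit[OF V(1,3) f(2,3) \<gamma>(1) c tie(1) T(1) _ C, of x0 "{}"] F f(1) by auto
  then have "f S - sum c S \<le> f R - sum c R"
    unfolding R_def by (intro modified_roi_maximal tie(2))
  moreover have "\<gamma> * f T \<le> f T" using F \<gamma> by simp
  ultimately show ?thesis using S unfolding x0_def by linarith
qed

theorem theorem3:
  "\<exists>q :: nat \<Rightarrow> real. q \<in> O(\<lambda>n. real n ^ 2) \<and>
    (\<forall>(V :: 'a set) (f :: 'a set \<Rightarrow> real) (\<gamma> :: real) (c :: 'a \<Rightarrow> real)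
       (vs :: 'a list) (tie :: 'a set \<Rightarrow> 'a) (tie_out :: 'a set set \<Rightarrow> 'a set) (OPT :: 'a set).
       finite V \<longrightarrow>
       (\<forall>S\<subseteq>V. f S \<ge> 0) \<longrightarrow> f {} = 0 \<longrightarrow> mono_on (Pow V) f \<longrightarrow>
       0 < \<gamma> \<longrightarrow> \<gamma> \<le> 1 \<longrightarrow> weakly_submodular_on V \<gamma> f \<longrightarrow>
       (\<forall>x\<in>V. c x > 0) \<longrightarrow>
       distinct vs \<longrightarrow> set vs = V \<longrightarrow>
       (\<forall>A. A \<noteq> {} \<longrightarrow> tie A \<in> A) \<longrightarrow> (\<forall>A. A \<noteq> {} \<longrightarrow> tie_out A \<in> A) \<longrightarrow>
       is_arg_max (\<lambda>T. f T - sum c T) (\<lambda>T. T \<subseteq> V) OPT \<longrightarrow>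
       (let alg = modified_roi vs c \<gamma> tie tie_out; S = result f alg in
          real (num_calls f alg) \<le> q (card V) \<and>
          f S - sum c S \<ge>
            \<gamma> * f OPT - sum c OPT - sum c OPT / \<gamma> * ln (f OPT / sum c OPT)))"
proof (intro exI[of _ "\<lambda>n. 2 * real n ^ 2 + real n + 1"] conjI allI impI, goal_cases)
  case 1
  show ?case
  \<comment> \<open>For \<open>n \<ge> 1\<close> both lower-order terms are at most the square,
    giving 2 + 1 + 1 = 4.\<close>
  proof (rule bigoI[of _ 4], rule eventually_sequentiallyI[of 1])
    fix n :: nat assume "1 \<le> n"
    then have "real n \<le> real n ^ 2" "1 \<le> real n ^ 2"
      by (auto intro: self_le_power simp del: of_nat_power)
    then show "norm (2 * real n ^ 2 + real n + 1) \<le> 4 * norm (real n ^ 2)"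
      unfolding real_norm_def by linarith
  qed
next
  case (2 V f \<gamma> c vs tie tie_out OPT)
  \<comment> \<open>Comparison with \<open>{}\<close>, whose profit is 0.\<close>
  then have "OPT \<subseteq> V" "sum c OPT \<le> f OPT"
    by (auto simp: is_arg_max_linorder dest: spec[of _ "{}"])
  moreover have "length vs = card V" using 2 distinct_card by fastforce
  then have "real (num_calls f (modified_roi vs c \<gamma> tie tie_out)) \<le> 2 * real (card V) ^ 2 + real (card V) + 1"
    using num_calls_modified_roi[of f vs c \<gamma> tie tie_out]
    by (simp flip: of_nat_power add: of_nat_le_iff)
  ultimately show ?case
    unfolding Let_def using 2 modified_roi_profit[of V vs f \<gamma> c tie tie_out OPT] by blast
qed

end
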